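(* In the setting below, if the restriction of $\eta$ to $\bar B_R$ is bounded, then $x$ is a Lebesgue point for $\eta$ with respect to $\mu$ if and only if $\mathbb{E}[|\eta(X^x_m)-\eta(x)|]\to0$ as $m\to\infty$.
   Context: Let $(\mathcal{X},d)$ be a metric space with Borel $\sigma$-algebra $\mathcal{B}$, $\eta:\mathcal{X}\to\mathbb{R}$ measurable, and $\mu:\mathcal{B}\to[0,\infty]$ a measure. Fix $x\in\mathcal{X}$ with $\mu(\bar B_r)>0$ for all $r>0$, where $\bar B_r=\{x':d(x,x')\le r\}$, and fix $R>0$ with $\mu(\bar B_R)<\infty$. The point $x$ is a Lebesgue point for $\eta$ with respect to $\mu$ if $\frac{1}{\mu(\bar B_r)}\int_{\bar B_r}|\eta(x')-\eta(x)|\,d\mu(x')\to0$ as $r\to0^+$. Let $\nu(A)=\mu(A\cap\bar B_R)/\mu(\bar B_R)$. Let $(\mathcal{Z}_m,\mathcal{G}_m,\nu_m)_{m\in\mathbb{N}}$ be arbitrary probability spaces, and on the product probability space $\Omega=\mathcal{X}\times\mathcal{X}^{\mathbb{N}}\times\prod_m\mathcal{Z}_m$ with product measure $\mathbb{P}=\nu\otimes\nu^{\otimes\mathbb{N}}\otimes\bigotimes_m\nu_m$ let $X,X_1,X_2,\dots$ and $\Theta_1,\Theta_2,\dots$ be the coordinate maps (so $X,X_1,\dots$ are i.i.d. with law $\nu$, independent of the $\Theta_m$'s). Let $\psi_m:[0,\infty)^m\times\mathcal{Z}_m\to\{1,\dots,m\}$ be measurable maps with $\psi_m(r_1,\dots,r_m,z)\in\arg\min_k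 r_k$ for all arguments, and set $X^x_m=X_{\psi_m(d(x,X_1),\dots,d(x,X_m),\Theta_m)}$. *)

theory Defs
  imports "HOL-Probability.Probability"
begin

definition lebesgue_point_wrt :: "'a::metric_space measure \<Rightarrow> ('a \<Rightarrow> real) \<Rightarrow> 'a \<Rightarrow> bool" where
  "lebesgue_point_wrt \<mu> \<eta> x \<longleftrightarrow>
     ((\<lambda>r. (\<integral>\<^sup>+ x'\<in>cball x r. ennreal \<bar>\<eta> x' - \<eta> x\<bar> \<partial>\<mu>) / emeasure \<mu> (cball x r))
        \<longlongrightarrow> 0) (at_right 0)"

text \<open>The nearest-neighbour sample X^x_m as a function of the sample point
  omega = (X, (X_k)_{k>=1}, (Theta_m)_{m>=1}).\<close>
definition nn_sample :: "(nat \<Rightarrow> (nat \<Rightarrow> real) \<Rightarrow> 'z \<Rightarrow> nat) \<Rightarrow> 'a::metric_space \<Rightarrow> nat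
    \<Rightarrow> 'a \<times> (nat \<Rightarrow> 'a) \<times> (nat \<Rightarrow> 'z) \<Rightarrow> 'a" where
  "nn_sample \<psi> x m \<omega> =
     (let xs = fst (snd \<omega>); zs = snd (snd \<omega>)
      in xs (\<psi> m (restrict (\<lambda>k. dist x (xs k)) {1..m}) (zs m)))"

end

theory Submission
  imports Defs
begin

text \<open>
  Let N be the normalised restriction of the measure to the ball of radius R and f the deviation
  of eta from its value at x. Conditioning on the position of the selected sample gives
  E f(X_m) = \<integral> f W_m dN, where W_m(y) is the sum over k of the probability that index k is
  selected when the k-th sample sits at y. Since the selected sample must be nearest, W_m(y) lies
  between m P(D > D(y))^(m-1) and m P(D \<ge> D(y))^(m-1) for D = d(x, -), whatever the tie-breaking
  rule is. These two bounds force W_m to be antitone in the distance, so the layer-cake formula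
  writes it as a mixture of indicators of balls and small ball averages of f give small
  \<integral> f W_m dN; the mass far from x is at most m P(D > \<delta>)^(m-1). Conversely, for m about
  1 / (2 N(B_r)) the lower bound and Bernoulli's inequality give W_m \<ge> 1 / (4 N(B_r)) on B_r, so
  the average of f over B_r is at most 4 E f(X_m). If x is an atom, m need not grow as r
  shrinks, but then x is a Lebesgue point because f(x) = 0.
\<close>

section \<open>Ball averages and antitone weights\<close>

text \<open>Continuity from below of \<open>density N f\<close> carries the bound from sublevel sets
  of \<open>D\<close> to every set closed downward in \<open>D\<close>. The slices of an antitone
  weight have this shape.\<close>

lemma nn_integral_sublevel_closed_le:
  fixes D :: "'a \<Rightarrow> real" and f :: "'a \<Rightarrow> ennreal"
  assumes [measurable]: "D \<in> borel_measurable N" "f \<in> borel_measurable N" "A \<in> sets N"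
    and down: "\<And>y y'. y \<in> A \<Longrightarrow> y' \<in> space N \<Longrightarrow> D y' \<le> D y \<Longrightarrow> y' \<in> A"
    and avg: "\<And>y. y \<in> A \<Longrightarrow>
      (\<integral>\<^sup>+ y'\<in>{y'\<in>space N. D y' \<le> D y}. f y' \<partial>N) \<le> c * emeasure N {y'\<in>space N. D y' \<le> D y}"
  shows "(\<integral>\<^sup>+ y\<in>A. f y \<partial>N) \<le> c * emeasure N A"
proof (cases "A = {}")
  case False
  let ?L = "\<lambda>y. {y'\<in>space N. D y' \<le> D y}"
  have A_space: "A \<subseteq> space N" by (rule sets.sets_into_space) fact
  \<comment> \<open>The sublevel-closed set is an increasing union of sublevel sets, even if \<open>D\<close> has no maximum on it.\<close>
  have "\<exists>s :: nat \<Rightarrow> 'a. range s \<subseteq> A \<and> incseq (\<lambda>n. D (s n)) \<and> (\<forall>y\<in>A. \<exists>n. D y \<le> D (s n))"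
  proof (cases "\<exists>a\<in>A. \<forall>y\<in>A. D y \<le> D a")
    case True
    then obtain a where "a \<in> A" "\<forall>y\<in>A. D y \<le> D a" by blast
    then show ?thesis by (intro exI[of _ "\<lambda>_. a"]) (auto simp: incseq_def)
  next
    case no_max: False
    \<comment> \<open>The supremum is taken in \<open>ereal\<close> because \<open>D\<close> may be
      unbounded on \<open>A\<close>.\<close>
    obtain g :: "nat \<Rightarrow> ereal" where g: "incseq g" "range g \<subseteq> (\<lambda>y. ereal (D y)) ` A"
      "(SUP y\<in>A. ereal (D y)) = (SUP i. g i)"
      using Sup_countable_SUP[of "(\<lambda>y. ereal (D y)) ` A"] False by auto
    from g(2) have "\<exists>y. y \<in> A \<and> g n = ereal (D y)" for n by (auto simp: image_iff subset_iff)
    then obtain s where s: "\<And>n. s n \<in> A" "\<And>n. g n = ereal (D (s n))" by metis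
    \<comment> \<open>Without a maximum, \<open>D y\<close> lies strictly below the supremum, so
      some \<open>D (s n)\<close> overtakes it.\<close>
    have "\<exists>n. D y \<le> D (s n)" if y: "y \<in> A" for y
    proof -
      obtain y' where y': "y' \<in> A" "D y < D y'" using no_max y by force
      then have "ereal (D y) < (SUP i. g i)"
        using SUP_upper[OF y'(1), of "\<lambda>y. ereal (D y)"] unfolding g(3)
        by (meson ereal_less_le less_ereal.simps(1) order_less_le_trans)
      then show ?thesis using s(2) by (auto simp: less_SUP_iff intro: less_imp_le)
    qed
    with s g(1) show ?thesis by (intro exI[of _ s]) (auto simp: incseq_def)
  qed
  then obtain s :: "nat \<Rightarrow> 'a" where s: "\<And>n. s n \<in> A" "incseq (\<lambda>n. D (s n))"
    "\<And>y. y \<in> A \<Longrightarrow> \<exists>n. D y \<le> D (s n)" by blast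
  have UN: "A = (\<Union>n. ?L (s n))"
    using s(1,3) down A_space by fast
  have inc: "incseq (\<lambda>n. ?L (s n))"
    using s(2) by (auto simp: incseq_def intro: order_trans)
  have "(\<integral>\<^sup>+ y\<in>A. f y \<partial>N) = emeasure (density N f) A"
    by (simp add: emeasure_density)
  also have "\<dots> = (SUP n. emeasure (density N f) (?L (s n)))"
    unfolding UN by (rule SUP_emeasure_incseq[symmetric]) (use inc in auto)
  also have "\<dots> \<le> c * emeasure N A"
  proof (rule SUP_least)
    fix n
    have "emeasure (density N f) (?L (s n)) \<le> c * emeasure N (?L (s n))"
      using avg[OF s(1)] by (simp add: emeasure_density)
    also have "\<dots> \<le> c * emeasure N A"
      by (intro mult_left_mono emeasure_mono) (use UN in auto)
    finally show "emeasure (density N f) (?L (s n)) \<le> c * emeasure N A" .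
  qed
  finally show ?thesis .
qed simp

text \<open>Tonelli's theorem, after writing \<open>W y\<close> as the length of the interval of
  levels \<open>{0..<w}\<close>. Negative levels are cut off because \<open>ennreal\<close> sends
  them to 0, which would count them whenever \<open>W y\<close> is positive.\<close>

lemma (in sigma_finite_measure) nn_integral_layer_cake:
  fixes W :: "'a \<Rightarrow> ennreal"
  assumes [measurable]: "f \<in> borel_measurable M" "W \<in> borel_measurable M"
    and fin: "\<And>y. y \<in> space M \<Longrightarrow> W y < \<infinity>"
  shows "(\<integral>\<^sup>+ y. f y * W y \<partial>M) =
    (\<integral>\<^sup>+ t\<in>{0..}. (\<integral>\<^sup>+ y\<in>{y\<in>space M. ennreal t < W y}. f y \<partial>M) \<partial>lborel)"
proof -
  interpret pair_sigma_finite M lborel by unfold_locales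
  let ?h = "\<lambda>y t. f y * indicator {y\<in>space M. ennreal t < W y} y * indicator {0..} t"
  have cake: "(\<integral>\<^sup>+ t. ?h y t \<partial>lborel) = f y * W y" if y: "y \<in> space M" for y
  proof -
    obtain w where w: "W y = ennreal w" "0 \<le> w"
      using fin[OF y] by (cases "W y") auto
    have "(\<integral>\<^sup>+ t. ?h y t \<partial>lborel) = (\<integral>\<^sup>+ t. f y * indicator {0..<w} t \<partial>lborel)"
      using y w by (intro nn_integral_cong) (auto simp: indicator_def ennreal_less_iff)
    also have "\<dots> = f y * W y"
      using w by (simp add: nn_integral_cmult)
    finally show ?thesis .
  qed
  have "(\<integral>\<^sup>+ y. f y * W y \<partial>M) = (\<integral>\<^sup>+ y. \<integral>\<^sup>+ t. ?h y t \<partial>lborel \<partial>M)"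
    by (intro nn_integral_cong) (simp add: cake)
  also have "\<dots> = (\<integral>\<^sup>+ t. \<integral>\<^sup>+ y. ?h y t \<partial>M \<partial>lborel)"
    by (rule Fubini'[symmetric]) measurable
  also have "\<dots> = (\<integral>\<^sup>+ t\<in>{0..}. (\<integral>\<^sup>+ y\<in>{y\<in>space M. ennreal t < W y}. f y \<partial>M) \<partial>lborel)"
    by (intro nn_integral_cong nn_integral_multc) measurable
  finally show ?thesis .
qed

text \<open>By \<open>anti\<close>, each superlevel set of \<open>W\<close> cut with the
  \<delta>-sublevel set of \<open>D\<close> is closed downward in \<open>D\<close>, so its
  \<open>f\<close>-integral is at most \<open>c\<close> times its mass. Integrating over the levels
  turns these masses back into the integral of \<open>W\<close>.\<close>

lemma (in sigma_finite_measure) nn_integral_antimono_weight_le: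
  fixes D :: "'a \<Rightarrow> real" and f W :: "'a \<Rightarrow> ennreal"
  assumes [measurable]: "D \<in> borel_measurable M" "f \<in> borel_measurable M" "W \<in> borel_measurable M"
    and fin: "\<And>y. y \<in> space M \<Longrightarrow> W y < \<infinity>"
    and anti: "\<And>y y'. y \<in> space M \<Longrightarrow> y' \<in> space M \<Longrightarrow> D y' \<le> D y \<Longrightarrow> W y \<le> W y'"
    and avg: "\<And>y. y \<in> space M \<Longrightarrow> D y \<le> \<delta> \<Longrightarrow>
      (\<integral>\<^sup>+ y'\<in>{y'\<in>space M. D y' \<le> D y}. f y' \<partial>M) \<le> c * emeasure M {y'\<in>space M. D y' \<le> D y}"
  shows "(\<integral>\<^sup>+ y\<in>{y\<in>space M. D y \<le> \<delta>}. f y * W y \<partial>M) \<le> c * (\<integral>\<^sup>+ y. W y \<partial>M)"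
proof -
  define B where "B = {y\<in>space M. D y \<le> \<delta>}"
  have [measurable]: "B \<in> sets M" unfolding B_def by measurable
  have slice: "(\<integral>\<^sup>+ y\<in>{y\<in>space M. ennreal t < W y}. f y * indicator B y \<partial>M)
      \<le> c * (\<integral>\<^sup>+ y\<in>{y\<in>space M. ennreal t < W y}. 1 \<partial>M)" for t
  proof -
    let ?A = "{y\<in>space M. ennreal t < W y} \<inter> B"
    have "(\<integral>\<^sup>+ y\<in>{y\<in>space M. ennreal t < W y}. f y * indicator B y \<partial>M) = (\<integral>\<^sup>+ y\<in>?A. f y \<partial>M)"
      by (intro nn_integral_cong) (auto simp: indicator_def)
    also have "\<dots> \<le> c * emeasure M ?A"
    proof (rule nn_integral_sublevel_closed_le)
      fix y y' assume "y \<in> ?A" "y' \<in> space M" "D y' \<le> D y"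
      then show "y' \<in> ?A"
        using anti[of y y'] by (auto simp: B_def intro: order_less_le_trans)
    qed (auto simp: B_def intro!: avg)
    also have "\<dots> \<le> c * emeasure M {y\<in>space M. ennreal t < W y}"
      by (intro mult_left_mono emeasure_mono) auto
    finally show ?thesis by simp
  qed
  have "(\<integral>\<^sup>+ y\<in>B. f y * W y \<partial>M) = (\<integral>\<^sup>+ y. (f y * indicator B y) * W y \<partial>M)"
    by (intro nn_integral_cong) (simp add: mult_ac)
  also have "\<dots> = (\<integral>\<^sup>+ t\<in>{0..}. (\<integral>\<^sup>+ y\<in>{y\<in>space M. ennreal t < W y}. f y * indicator B y \<partial>M) \<partial>lborel)"
    by (rule nn_integral_layer_cake) (use fin in auto)
  also have "\<dots> \<le> (\<integral>\<^sup>+ t. c * ((\<integral>\<^sup>+ y\<in>{y\<in>space M. ennreal t < W y}. 1 \<partial>M) * indicator {0..} t) \<partial>lborel)"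
    using slice by (intro nn_integral_mono) (auto simp: indicator_def)
  also have "\<dots> = c * (\<integral>\<^sup>+ t\<in>{0..}. (\<integral>\<^sup>+ y\<in>{y\<in>space M. ennreal t < W y}. 1 \<partial>M) \<partial>lborel)"
    by (rule nn_integral_cmult) measurable
  \<comment> \<open>The layer-cake formula with the constant 1 in place of \<open>f\<close>, read
    backwards.\<close>
  also have "\<dots> = c * (\<integral>\<^sup>+ y. W y \<partial>M)"
    using nn_integral_layer_cake[of "\<lambda>_. 1" W] fin by simp
  finally show ?thesis by (simp add: B_def)
qed

section \<open>Equivalence for abstract nearest-neighbour weights\<close>

text \<open>Here \<open>D\<close> models the distance to the centre, \<open>f\<close> the deviation
  from the central value and \<open>W m\<close> the density of the law of the selected sample. The
  two-sided bounds compare weights at different distances only; \<open>W_cong\<close> covers equal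
  ones. The bound on \<open>f\<close> holds almost everywhere because the deviation will be
  controlled only on the ball that carries \<open>M\<close>.\<close>

locale nearest_weights = prob_space M for M :: "'a measure" +
  fixes D :: "'a \<Rightarrow> real" and f :: "'a \<Rightarrow> ennreal" and W :: "nat \<Rightarrow> 'a \<Rightarrow> ennreal" and C :: real
  assumes D_meas[measurable]: "D \<in> borel_measurable M"
    and D_nonneg: "\<And>y. 0 \<le> D y"
    and f_meas[measurable]: "f \<in> borel_measurable M"
    and f_center: "\<And>y. D y = 0 \<Longrightarrow> f y = 0"
    and C_nonneg: "0 \<le> C"
    and f_bound: "AE y in M. f y \<le> ennreal C"
    and W_meas[measurable]: "\<And>m. m \<ge> 1 \<Longrightarrow> W m \<in> borel_measurable M"
    and W_integral: "\<And>m. m \<ge> 1 \<Longrightarrow> (\<integral>\<^sup>+ y. W m y \<partial>M) = 1"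
    and W_upper: "\<And>m y. m \<ge> 1 \<Longrightarrow> y \<in> space M \<Longrightarrow>
      W m y \<le> of_nat m * emeasure M {y'\<in>space M. D y \<le> D y'} ^ (m - 1)"
    and W_lower: "\<And>m y. m \<ge> 1 \<Longrightarrow> y \<in> space M \<Longrightarrow>
      of_nat m * emeasure M {y'\<in>space M. D y < D y'} ^ (m - 1) \<le> W m y"
    and W_cong: "\<And>m y y'. m \<ge> 1 \<Longrightarrow> D y = D y' \<Longrightarrow> W m y = W m y'"
    and ball_pos: "\<And>r. 0 < r \<Longrightarrow> 0 < emeasure M {y\<in>space M. D y \<le> r}"
begin

abbreviation sublevel :: "real \<Rightarrow> 'a set" where
  "sublevel r \<equiv> {y\<in>space M. D y \<le> r}"

abbreviation average :: "real \<Rightarrow> ennreal" where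
  "average r \<equiv> (\<integral>\<^sup>+ y\<in>sublevel r. f y \<partial>M) / emeasure M (sublevel r)"

text \<open>The upper weight bound at a distance never exceeds the lower bound at a smaller one.\<close>
lemma W_antimono:
  assumes m: "m \<ge> 1" and y: "y \<in> space M" "y' \<in> space M" "D y' \<le> D y"
  shows "W m y \<le> W m y'"
proof (cases "D y' = D y")
  case True
  then show ?thesis using W_cong[OF m, of y y'] by simp
next
  case False
  have "W m y \<le> of_nat m * emeasure M {z\<in>space M. D y \<le> D z} ^ (m - 1)"
    by (rule W_upper[OF m y(1)])
  also have "\<dots> \<le> of_nat m * emeasure M {z\<in>space M. D y' < D z} ^ (m - 1)"
    using False y by (intro mult_left_mono power_mono emeasure_mono) auto
  also have "\<dots> \<le> W m y'" by (rule W_lower[OF m y(2)])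
  finally show ?thesis .
qed

lemma emeasure_superlevel: "emeasure M {y\<in>space M. r < D y} = ennreal (1 - prob (sublevel r))"
proof -
  have "{y\<in>space M. r < D y} = space M - sublevel r" by auto
  then show ?thesis by (simp add: emeasure_eq_measure prob_compl)
qed

text \<open>The integral is split at distance \<delta>. Inside, small averages and total weight 1
  give at most \<open>e / 2\<close>. Outside, \<open>f\<close> is at most \<open>C\<close> almost
  everywhere and the weight is at most \<open>m * s ^ (m - 1)\<close>, where \<open>s\<close> is the
  mass beyond \<delta>.\<close>

lemma weighted_integral_tendsto_0:
  assumes lim: "(average \<longlongrightarrow> 0) (at_right 0)"
  shows "(\<lambda>m. \<integral>\<^sup>+ y. f y * W m y \<partial>M) \<longlonglongrightarrow> 0"
proof (rule order_tendstoI)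
  fix a :: ennreal assume "0 < a"
  then obtain b where b: "0 < b" "b < a" using dense by blast
  then obtain e where e: "b = ennreal e" "0 < e"
    by (cases b) (auto simp: less_top[symmetric])
  have "eventually (\<lambda>r. average r < ennreal (e / 2)) (at_right 0)"
    using e by (intro order_tendstoD[OF lim]) auto
  then obtain d where d: "0 < d" "\<And>r. 0 < r \<Longrightarrow> r < d \<Longrightarrow> average r < ennreal (e / 2)"
    unfolding eventually_at_right_field by auto
  \<comment> \<open>Halving keeps the radius \<delta> itself inside the open range on which the
    averages are small.\<close>
  define \<delta> where "\<delta> = d / 2"
  have \<delta>: "0 < \<delta>" "\<delta> < d" using d by (auto simp: \<delta>_def)
  \<comment> \<open>The one-sided limit says nothing about radius 0; there the integral vanishes by
    \<open>f_center\<close>.\<close>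
  have avg: "(\<integral>\<^sup>+ y'\<in>sublevel (D y). f y' \<partial>M) \<le> ennreal (e / 2) * emeasure M (sublevel (D y))"
    if "D y \<le> \<delta>" for y
  proof (cases "D y = 0")
    case True
    have "(\<integral>\<^sup>+ y'\<in>sublevel (D y). f y' \<partial>M) = (\<integral>\<^sup>+ y'. 0 \<partial>M)"
      using True D_nonneg by (intro nn_integral_cong) (auto simp: indicator_def intro: f_center antisym)
    then show ?thesis by simp
  next
    case False
    then have D: "0 < D y" using D_nonneg[of y] by simp
    have "(\<integral>\<^sup>+ y'\<in>sublevel (D y). f y' \<partial>M) = average (D y) * emeasure M (sublevel (D y))"
      using ball_pos[OF D] by (simp add: ennreal_divide_times ennreal_mult_divide_eq less_top[symmetric])
    also have "\<dots> \<le> ennreal (e / 2) * emeasure M (sublevel (D y))"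
      using d(2)[OF D] that \<delta> by (intro mult_right_mono) auto
    finally show ?thesis .
  qed
  define s where "s = 1 - prob (sublevel \<delta>)"
  have s: "0 \<le> s" "s < 1"
    using ball_pos[OF \<delta>(1)] by (auto simp: s_def emeasure_eq_measure)
  have bound: "(\<integral>\<^sup>+ y. f y * W m y \<partial>M) \<le> ennreal (e / 2) + ennreal (C * (m * s ^ (m - 1)))"
    if m: "m \<ge> 1" for m
  proof -
    note [measurable] = W_meas[OF m]
    have W_fin: "W m y < \<infinity>" if "y \<in> space M" for y
    proof -
      have "of_nat m * emeasure M {y'\<in>space M. D y \<le> D y'} ^ (m - 1) < \<infinity>"
        by (simp add: emeasure_eq_measure ennreal_power ennreal_mult_less_top ennreal_of_nat_eq_real_of_nat)
      with W_upper[OF m that] show ?thesis by (rule order_le_less_trans)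
    qed
    have "(\<integral>\<^sup>+ y. f y * W m y \<partial>M) =
      (\<integral>\<^sup>+ y. f y * W m y * indicator (sublevel \<delta>) y + f y * W m y * indicator {y\<in>space M. \<delta> < D y} y \<partial>M)"
      by (intro nn_integral_cong) (auto simp: indicator_def)
    also have "\<dots> = (\<integral>\<^sup>+ y\<in>sublevel \<delta>. f y * W m y \<partial>M) + (\<integral>\<^sup>+ y\<in>{y\<in>space M. \<delta> < D y}. f y * W m y \<partial>M)"
      by (rule nn_integral_add) measurable
    also have "\<dots> \<le> ennreal (e / 2) + ennreal (C * (m * s ^ (m - 1)))"
    proof (rule add_mono)
      have "(\<integral>\<^sup>+ y\<in>sublevel \<delta>. f y * W m y \<partial>M) \<le> ennreal (e / 2) * (\<integral>\<^sup>+ y. W m y \<partial>M)"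
        by (rule nn_integral_antimono_weight_le[OF D_meas f_meas W_meas[OF m] W_fin])
          (auto intro!: W_antimono m avg)
      then show "(\<integral>\<^sup>+ y\<in>sublevel \<delta>. f y * W m y \<partial>M) \<le> ennreal (e / 2)"
        by (simp add: W_integral[OF m])
    next
      have "(\<integral>\<^sup>+ y\<in>{y\<in>space M. \<delta> < D y}. f y * W m y \<partial>M) \<le> (\<integral>\<^sup>+ y. ennreal (C * (m * s ^ (m - 1))) \<partial>M)"
      proof (rule nn_integral_mono_AE, use f_bound AE_space[of M] in eventually_elim)
        case (elim y)
        show "f y * W m y * indicator {y\<in>space M. \<delta> < D y} y \<le> ennreal (C * (m * s ^ (m - 1)))"
        proof (cases "\<delta> < D y")
          case True
          have "W m y \<le> of_nat m * emeasure M {y'\<in>space M. D y \<le> D y'} ^ (m - 1)"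
            using W_upper m elim by simp
          also have "\<dots> \<le> of_nat m * emeasure M {y\<in>space M. \<delta> < D y} ^ (m - 1)"
            using True by (intro mult_left_mono power_mono emeasure_mono) auto
          also have "\<dots> = ennreal (m * s ^ (m - 1))"
            using s by (simp add: emeasure_superlevel s_def[symmetric] ennreal_power ennreal_mult ennreal_of_nat_eq_real_of_nat)
          finally have "f y * W m y \<le> ennreal C * ennreal (m * s ^ (m - 1))"
            using elim by (intro mult_mono) auto
          also have "\<dots> = ennreal (C * (m * s ^ (m - 1)))"
            using C_nonneg s by (simp add: ennreal_mult)
          finally show ?thesis by (auto simp: indicator_def)
        qed simp
      qed
      then show "(\<integral>\<^sup>+ y\<in>{y\<in>space M. \<delta> < D y}. f y * W m y \<partial>M) \<le> ennreal (C * (m * s ^ (m - 1)))"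
        by (simp add: emeasure_space_1)
    qed
    finally show ?thesis .
  qed
  \<comment> \<open>The sum is \<open>(n + 1) * s ^ n\<close>, the wanted sequence shifted by one,
    so that no truncated exponent appears.\<close>
  have "(\<lambda>n. real n * s ^ n + s ^ n) \<longlonglongrightarrow> 0 + 0"
    using s by (intro tendsto_add powser_times_n_limit_0 LIMSEQ_power_zero) auto
  then have "(\<lambda>n. C * (real (Suc n) * s ^ (Suc n - 1))) \<longlonglongrightarrow> C * 0"
    by (intro tendsto_mult tendsto_const) (simp add: algebra_simps)
  then have "(\<lambda>m. C * (real m * s ^ (m - 1))) \<longlonglongrightarrow> 0"
    by (subst filterlim_sequentially_Suc[symmetric]) simp
  then have "eventually (\<lambda>m. C * (real m * s ^ (m - 1)) < e / 2) sequentially"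
    using e by (intro order_tendstoD) auto
  then show "eventually (\<lambda>m. (\<integral>\<^sup>+ y. f y * W m y \<partial>M) < a) sequentially"
    using eventually_ge_at_top[of 1]
  proof eventually_elim
    case (elim m)
    have "(\<integral>\<^sup>+ y. f y * W m y \<partial>M) \<le> ennreal (e / 2) + ennreal (C * (m * s ^ (m - 1)))"
      by (rule bound) (use elim in simp)
    also have "\<dots> \<le> ennreal (e / 2) + ennreal (e / 2)"
      using elim by (intro add_left_mono ennreal_leI) simp
    also have "\<dots> = b" using e by (simp flip: ennreal_plus)
    finally show ?case using b by simp
  qed
qed simp

text \<open>The mass of a ball as a function of its radius is the distribution function of
  \<open>D\<close>, which is right-continuous. Whether its value at 0 vanishes decides between the
  next two lemmas.\<close>

lemma prob_sublevel_tendsto: "((\<lambda>r. prob (sublevel r)) \<longlongrightarrow> prob (sublevel 0)) (at_right 0)"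
proof -
  interpret DM: real_distribution "distr M borel D"
    by (rule real_distribution_distr) simp
  have "cdf (distr M borel D) = (\<lambda>r. prob (sublevel r))"
    by (simp add: cdf_def fun_eq_iff measure_distr vimage_def Int_def conj_commute)
  then show ?thesis
    using DM.cdf_is_right_cont[of 0] by (simp add: continuous_within)
qed

text \<open>Since \<open>f\<close> vanishes where \<open>D\<close> is 0, only the shell between
  radii 0 and \<open>r\<close> contributes. Its mass tends to 0 while the mass of the ball stays at
  least \<open>p 0 > 0\<close>.\<close>

lemma average_tendsto_0_atom:
  assumes atom: "prob (sublevel 0) \<noteq> 0"
  shows "(average \<longlongrightarrow> 0) (at_right 0)"
proof -
  define p where "p r = prob (sublevel r)" for r
  have p0: "0 < p 0" using atom by (simp add: p_def zero_less_measure_iff)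
  have "((\<lambda>r. C * (p r - p 0) / p r) \<longlongrightarrow> C * (p 0 - p 0) / p 0) (at_right 0)"
    unfolding p_def by (intro tendsto_intros prob_sublevel_tendsto) (use atom in simp)
  then have lim: "((\<lambda>r. ennreal (C * (p r - p 0) / p r)) \<longlongrightarrow> 0) (at_right 0)"
    using tendsto_ennrealI by fastforce
  have bound: "average r \<le> ennreal (C * (p r - p 0) / p r)" if r: "0 < r" for r
  proof -
    have mono: "p 0 \<le> p r" unfolding p_def using r by (intro finite_measure_mono) auto
    have "(\<integral>\<^sup>+ y\<in>sublevel r. f y \<partial>M) \<le> (\<integral>\<^sup>+ y. ennreal C * indicator (sublevel r - sublevel 0) y \<partial>M)"
    proof (rule nn_integral_mono_AE, use f_bound AE_space[of M] in eventually_elim)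
      case (elim y)
      then show ?case
        using D_nonneg[of y] f_center[of y] by (auto simp: indicator_def)
    qed
    also have "\<dots> = ennreal (C * (p r - p 0))"
      using r C_nonneg mono
      by (simp add: nn_integral_cmult emeasure_eq_measure p_def ennreal_mult
        finite_measure_Diff[of "sublevel r" "sublevel 0"] subset_eq)
    finally have "average r \<le> ennreal (C * (p r - p 0)) / ennreal (p r)"
      using divide_right_mono_ennreal by (simp add: emeasure_eq_measure p_def)
    also have "\<dots> = ennreal (C * (p r - p 0) / p r)"
      using p0 mono C_nonneg by (intro divide_ennreal) auto
    finally show ?thesis .
  qed
  show ?thesis
    by (rule tendsto_sandwich[OF _ _ tendsto_const lim])
      (auto simp: eventually_at_right_field intro!: bound exI[of _ 1])
qed

text \<open>Each radius \<open>r\<close> is matched with a sample size \<open>k r\<close> for which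
  the weight on the ball is at least a quarter of the reciprocal of its mass. Without an atom
  \<open>k r\<close> tends to infinity, so the assumed limit can be read along it.\<close>

lemma average_tendsto_0_nonatom:
  assumes nonatom: "prob (sublevel 0) = 0"
    and lim: "(\<lambda>m. \<integral>\<^sup>+ y. f y * W m y \<partial>M) \<longlonglongrightarrow> 0"
  shows "(average \<longlongrightarrow> 0) (at_right 0)"
proof -
  define p where "p r = prob (sublevel r)" for r
  \<comment> \<open>This size balances two demands: \<open>k r * p r\<close> is at least 1/2, while
    \<open>(k r - 1) * p r\<close> is at most 1/2, which keeps \<open>(1 - p r) ^ (k r - 1)\<close>
    away from 0.\<close>
  define k where "k r = nat \<lceil>1 / (2 * p r)\<rceil>" for r
  have p_pos: "0 < p r" if "0 < r" for r
    using ball_pos[OF that] by (simp add: p_def emeasure_eq_measure)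
  have p_le: "p r \<le> 1" for r by (simp add: p_def)
  have k: "k r \<ge> 1" "1 / (2 * p r) \<le> real (k r)" "real (k r) - 1 \<le> 1 / (2 * p r)" if "0 < r" for r
    using p_pos[OF that] by (auto simp: k_def Suc_le_eq)
  \<comment> \<open>Convergence to 0 through positive values is what makes the reciprocal tend to
    plus infinity.\<close>
  have "filterlim p (at_right 0) (at_right 0)"
    unfolding filterlim_at p_def[abs_def]
    using prob_sublevel_tendsto nonatom p_pos
    by (force simp: p_def eventually_at_right_field intro!: exI[of _ 1])
  then have "filterlim (\<lambda>r. 2 * p r) (at_right 0) (at_right 0)"
    by (auto simp: filterlim_at intro: tendsto_mult_right_zero)
  then have "filterlim (\<lambda>r. 1 / (2 * p r)) at_top (at_right 0)"
    using filterlim_compose[OF filterlim_inverse_at_top_right] by (simp add: inverse_eq_divide)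
  then have "filterlim (\<lambda>r. real (k r)) at_top (at_right 0)"
    by (rule filterlim_at_top_mono) (auto simp: eventually_at_right_field intro!: k exI[of _ 1])
  then have "filterlim k sequentially (at_right 0)"
    by (simp add: filterlim_sequentially_iff_filterlim_real)
  from filterlim_compose[OF lim this]
  have "((\<lambda>r. 4 * (\<integral>\<^sup>+ y. f y * W (k r) y \<partial>M)) \<longlongrightarrow> 4 * 0) (at_right 0)"
    by (intro ennreal_tendsto_cmult) auto
  then have lim': "((\<lambda>r. 4 * (\<integral>\<^sup>+ y. f y * W (k r) y \<partial>M)) \<longlongrightarrow> 0) (at_right 0)"
    by simp
  have bound: "average r \<le> 4 * (\<integral>\<^sup>+ y. f y * W (k r) y \<partial>M)" if r: "0 < r" for r
  proof -
    have "1 / 2 \<le> 1 - (real (k r) - 1) * p r"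
      using k(3)[OF r] p_pos[OF r] by (simp add: field_simps)
    also have "\<dots> = 1 + real (k r - 1) * (- p r)"
      using k(1)[OF r] by (simp add: of_nat_diff)
    also have "\<dots> \<le> (1 + (- p r)) ^ (k r - 1)"
      by (rule Bernoulli_inequality) (use p_le in simp)
    finally have half: "1 / 2 \<le> (1 - p r) ^ (k r - 1)" by simp
    have "1 / (4 * p r) = 1 / (2 * p r) * (1 / 2)" by simp
    also have "\<dots> \<le> real (k r) * (1 - p r) ^ (k r - 1)"
      using k(2)[OF r] half p_pos[OF r] by (intro mult_mono) auto
    finally have quarter: "1 / (4 * p r) \<le> real (k r) * (1 - p r) ^ (k r - 1)" .
    have W_ge: "ennreal (1 / (4 * p r)) \<le> W (k r) y" if y: "y \<in> sublevel r" for y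
    proof -
      have "ennreal (1 / (4 * p r)) \<le> ennreal (real (k r) * (1 - p r) ^ (k r - 1))"
        by (rule ennreal_leI) (rule quarter)
      also have "\<dots> = of_nat (k r) * emeasure M {y'\<in>space M. r < D y'} ^ (k r - 1)"
        using p_le by (simp add: emeasure_superlevel p_def[symmetric] ennreal_power ennreal_mult ennreal_of_nat_eq_real_of_nat)
      \<comment> \<open>For \<open>y\<close> in the ball, points farther than \<open>r\<close> are
        farther than \<open>D y\<close>, so one bound serves the whole ball.\<close>
      also have "\<dots> \<le> of_nat (k r) * emeasure M {y'\<in>space M. D y < D y'} ^ (k r - 1)"
        using y by (intro mult_left_mono power_mono emeasure_mono) auto
      also have "\<dots> \<le> W (k r) y"
        using y by (intro W_lower k r) auto
      finally show ?thesis .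
    qed
    have "average r = (\<integral>\<^sup>+ y. ennreal (1 / p r) * (f y * indicator (sublevel r) y) \<partial>M)"
      using p_pos[OF r]
      by (simp add: nn_integral_cmult emeasure_eq_measure p_def[symmetric] divide_ennreal_def mult.commute
        inverse_ennreal inverse_eq_divide)
    also have "\<dots> \<le> (\<integral>\<^sup>+ y. 4 * (f y * W (k r) y) \<partial>M)"
    proof (rule nn_integral_mono)
      fix y assume "y \<in> space M"
      have "ennreal (1 / p r) = 4 * ennreal (1 / (4 * p r))"
        using p_pos[OF r] by (simp add: ennreal_mult[symmetric] flip: ennreal_numeral)
      then show "ennreal (1 / p r) * (f y * indicator (sublevel r) y) \<le> 4 * (f y * W (k r) y)"
        using W_ge[of y] by (auto simp: indicator_def mult_ac intro!: mult_left_mono)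
    qed
    also have "\<dots> = 4 * (\<integral>\<^sup>+ y. f y * W (k r) y \<partial>M)"
      by (intro nn_integral_cmult borel_measurable_times_ennreal f_meas W_meas k r)
    finally show ?thesis .
  qed
  show ?thesis
    by (rule tendsto_sandwich[OF _ _ tendsto_const lim'])
      (auto simp: eventually_at_right_field intro!: bound exI[of _ 1])
qed

theorem average_tendsto_0_iff:
  "(average \<longlongrightarrow> 0) (at_right 0) \<longleftrightarrow> (\<lambda>m. \<integral>\<^sup>+ y. f y * W m y \<partial>M) \<longlonglongrightarrow> 0"
  using weighted_integral_tendsto_0 average_tendsto_0_atom average_tendsto_0_nonatom by blast

end

section \<open>Law of the sample chosen by an arbitrary minimising rule\<close>

text \<open>The restriction makes the distance vector extensional, as in the product space on which
  \<open>sel\<close> will be assumed measurable and minimising. Values of \<open>v\<close> outside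
  \<open>I\<close> cannot influence the choice.\<close>

definition nearest_index ::
  "('a \<Rightarrow> real) \<Rightarrow> (('i \<Rightarrow> real) \<Rightarrow> 'z \<Rightarrow> 'i) \<Rightarrow> 'i set \<Rightarrow> ('i \<Rightarrow> 'a) \<Rightarrow> 'z \<Rightarrow> 'i" where
  "nearest_index D sel I v z = sel (\<lambda>k\<in>I. D (v k)) z"

locale argmin_selection = N: prob_space N + Z: prob_space Z
  for N :: "'a measure" and Z :: "'z measure" +
  fixes D :: "'a \<Rightarrow> real" and sel :: "('i \<Rightarrow> real) \<Rightarrow> 'z \<Rightarrow> 'i" and I :: "'i set"
  assumes D_meas[measurable]: "D \<in> borel_measurable N"
    and D_nonneg: "\<And>y. 0 \<le> D y"
    and I: "finite I"
    and sel_meas: "(\<lambda>(r, z). sel r z) \<in> measurable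
          ((\<Pi>\<^sub>M k\<in>I. restrict_space borel {0::real..}) \<Otimes>\<^sub>M Z) (count_space UNIV)"
    and sel_argmin: "\<And>r z. r \<in> (\<Pi>\<^sub>E k\<in>I. {0::real..}) \<Longrightarrow> z \<in> space Z \<Longrightarrow>
        sel r z \<in> I \<and> (\<forall>k\<in>I. r (sel r z) \<le> r k)"
begin

abbreviation "nearest \<equiv> nearest_index D sel I"

lemma measurable_nearest_index[measurable]: "(\<lambda>(v, z). nearest v z) \<in> (\<Pi>\<^sub>M k\<in>I. N) \<Otimes>\<^sub>M Z \<rightarrow>\<^sub>M count_space UNIV"
proof -
  have [measurable]: "D \<in> N \<rightarrow>\<^sub>M restrict_space borel {0..}"
    by (rule measurable_restrict_space2) (auto simp: D_nonneg)
  have "(\<lambda>(v, z). (\<lambda>k\<in>I. D (v k), z)) \<in>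
      (\<Pi>\<^sub>M k\<in>I. N) \<Otimes>\<^sub>M Z \<rightarrow>\<^sub>M (\<Pi>\<^sub>M k\<in>I. restrict_space borel {0::real..}) \<Otimes>\<^sub>M Z"
    by measurable
  from measurable_compose[OF this sel_meas] show ?thesis by (simp add: nearest_index_def case_prod_beta)
qed

lemma nearest_index_argmin:
  assumes "z \<in> space Z"
  shows "nearest v z \<in> I \<and> (\<forall>k\<in>I. D (v (nearest v z)) \<le> D (v k))"
proof -
  have "(\<lambda>k\<in>I. D (v k)) \<in> (\<Pi>\<^sub>E k\<in>I. {0..})" by (auto simp: D_nonneg)
  from sel_argmin[OF this assms] show ?thesis by (auto simp: nearest_index_def)
qed

text \<open>The selected index takes finitely many values, so the map is pieced together from
  coordinate projections. These are measurable only for indices in \<open>I\<close>, hence the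
  passage to \<open>count_space I\<close>.\<close>

lemma measurable_selected: "(\<lambda>(v, z). v (nearest v z)) \<in> (\<Pi>\<^sub>M k\<in>I. N) \<Otimes>\<^sub>M Z \<rightarrow>\<^sub>M N"
proof -
  have "(\<lambda>p. nearest (fst p) (snd p)) \<in> (\<Pi>\<^sub>M k\<in>I. N) \<Otimes>\<^sub>M Z \<rightarrow>\<^sub>M count_space I"
    using measurable_sets[OF measurable_nearest_index, of "{_}"] I
    by (auto simp: measurable_count_space_eq2 space_pair_measure nearest_index_argmin case_prod_beta')
  then have "(\<lambda>p. fst p (nearest (fst p) (snd p))) \<in> (\<Pi>\<^sub>M k\<in>I. N) \<Otimes>\<^sub>M Z \<rightarrow>\<^sub>M N"
    by (rule measurable_compose_countable'[rotated])
      (auto simp: I countable_finite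
        intro: measurable_compose[OF measurable_fst measurable_component_singleton])
  then show ?thesis by (simp add: case_prod_beta')
qed

text \<open>The density is built explicitly by conditioning on one coordinate at a time, not as a
  Radon-Nikodym derivative, so that the bounds and the dependence on \<open>D y\<close> alone hold
  at every point and not just almost everywhere.\<close>

lemma selected_density:
  obtains W :: "'a \<Rightarrow> ennreal" where
    "W \<in> borel_measurable N"
    "\<And>f. f \<in> borel_measurable N \<Longrightarrow>
       (\<integral>\<^sup>+ (v, z). f (v (nearest v z)) \<partial>((\<Pi>\<^sub>M k\<in>I. N) \<Otimes>\<^sub>M Z)) = (\<integral>\<^sup>+ y. f y * W y \<partial>N)"
    "\<And>y. y \<in> space N \<Longrightarrow>
       W y \<le> of_nat (card I) * emeasure N {y'\<in>space N. D y \<le> D y'} ^ (card I - 1)"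
    "\<And>y. y \<in> space N \<Longrightarrow>
       of_nat (card I) * emeasure N {y'\<in>space N. D y < D y'} ^ (card I - 1) \<le> W y"
    "\<And>y y'. D y = D y' \<Longrightarrow> W y = W y'"
proof -
  interpret P: product_prob_space "\<lambda>_::'i. N" UNIV by unfold_locales
  have [measurable]: "(\<lambda>p. indicator {k} (nearest (fst p) (snd p)) :: ennreal) \<in>
      borel_measurable ((\<Pi>\<^sub>M k\<in>I. N) \<Otimes>\<^sub>M Z)" for k
    using measurable_compose[OF measurable_nearest_index, of "indicator {k}" "borel :: ennreal measure"]
    by (simp add: case_prod_beta')
  \<comment> \<open>The probability that \<open>k\<close> is selected when sample \<open>k\<close>
    is pinned at \<open>y\<close> and all other samples and the tie-breaking variable are
    random.\<close>
  define w where "w k y = (\<integral>\<^sup>+ z. \<integral>\<^sup>+ v. indicator {k} (nearest (v(k := y)) z)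
      \<partial>(\<Pi>\<^sub>M j\<in>I - {k}. N) \<partial>Z)" for k y
  define W where "W y = (\<Sum>k\<in>I. w k y)" for y
  have upd: "(\<lambda>((y, z), v). (v(k := y), z)) \<in>
      (N \<Otimes>\<^sub>M Z) \<Otimes>\<^sub>M (\<Pi>\<^sub>M j\<in>I - {k}. N) \<rightarrow>\<^sub>M (\<Pi>\<^sub>M k\<in>I. N) \<Otimes>\<^sub>M Z" if "k \<in> I" for k
  proof -
    have "(\<lambda>(v, y). v(k := y)) \<in> (\<Pi>\<^sub>M j\<in>I - {k}. N) \<Otimes>\<^sub>M N \<rightarrow>\<^sub>M (\<Pi>\<^sub>M k\<in>I. N)"
      using measurable_add_dim[of k "I - {k}" "\<lambda>_. N"] that by (simp add: insert_absorb)
    then have "(\<lambda>p. (\<lambda>(v, y). v(k := y)) (snd p, fst (fst p))) \<in>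
        (N \<Otimes>\<^sub>M Z) \<Otimes>\<^sub>M (\<Pi>\<^sub>M j\<in>I - {k}. N) \<rightarrow>\<^sub>M (\<Pi>\<^sub>M k\<in>I. N)"
      by measurable
    then have [measurable]: "(\<lambda>p. (snd p)(k := fst (fst p))) \<in>
        (N \<Otimes>\<^sub>M Z) \<Otimes>\<^sub>M (\<Pi>\<^sub>M j\<in>I - {k}. N) \<rightarrow>\<^sub>M (\<Pi>\<^sub>M k\<in>I. N)"
      by simp
    show ?thesis unfolding case_prod_beta by measurable
  qed
  have upd_nearest: "(\<lambda>((y, z), v). nearest (v(k := y)) z) \<in>
      (N \<Otimes>\<^sub>M Z) \<Otimes>\<^sub>M (\<Pi>\<^sub>M j\<in>I - {k}. N) \<rightarrow>\<^sub>M count_space UNIV" if "k \<in> I" for k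
    using measurable_compose[OF upd[OF that] measurable_nearest_index] by (simp add: case_prod_beta')
  have Pfin: "prob_space (\<Pi>\<^sub>M j\<in>J. N)" for J :: "'i set"
    by (rule prob_space_PiM) unfold_locales
  have ind_meas: "(\<lambda>((y, z), v). indicator {k} (nearest (v(k := y)) z) :: ennreal) \<in> 
      borel_measurable ((N \<Otimes>\<^sub>M Z) \<Otimes>\<^sub>M (\<Pi>\<^sub>M j\<in>I - {k}. N))" if "k \<in> I" for k
    using measurable_compose[OF upd_nearest[OF that], of "indicator {k}" "borel :: ennreal measure"]
    by (simp add: case_prod_beta')
  have inner_meas: "(\<lambda>(y, z). \<integral>\<^sup>+ v. indicator {k} (nearest (v(k := y)) z) \<partial>(\<Pi>\<^sub>M j\<in>I - {k}. N))
      \<in> borel_measurable (N \<Otimes>\<^sub>M Z)" if "k \<in> I" for k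
  proof -
    interpret J: prob_space "\<Pi>\<^sub>M j\<in>I - {k}. N" by (rule Pfin)
    show ?thesis
      using J.borel_measurable_nn_integral_fst[OF ind_meas[OF that]] by (simp add: case_prod_beta')
  qed
  have w_meas: "w k \<in> borel_measurable N" if "k \<in> I" for k
    using Z.borel_measurable_nn_integral_fst[OF inner_meas[OF that]] by (simp add: w_def[abs_def])
  have slice: "(\<lambda>v. indicator {k} (nearest (v(k := y)) z) :: ennreal) \<in> borel_measurable (\<Pi>\<^sub>M j\<in>I - {k}. N)"
    if "k \<in> I" "y \<in> space N" "z \<in> space Z" for k y z
    using measurable_compose[OF measurable_Pair1'[of "(y, z)" "N \<Otimes>\<^sub>M Z" "\<Pi>\<^sub>M j\<in>I - {k}. N"] ind_meas[OF that(1)]] that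
    by (simp add: space_pair_measure)
  have slice2: "(\<lambda>z. \<integral>\<^sup>+ v. indicator {k} (nearest (v(k := y)) z) \<partial>(\<Pi>\<^sub>M j\<in>I - {k}. N)) \<in> borel_measurable Z"
    if "k \<in> I" "y \<in> space N" for k y
    using measurable_compose[OF measurable_Pair1'[of y N Z] inner_meas[OF that(1)]] that by simp
  have term_eq: "(\<integral>\<^sup>+ (v, z). f (v k) * indicator {k} (nearest v z) \<partial>((\<Pi>\<^sub>M k\<in>I. N) \<Otimes>\<^sub>M Z)) = (\<integral>\<^sup>+ y. f y * w k y \<partial>N)"
    if [measurable]: "f \<in> borel_measurable N" and k[measurable]: "k \<in> I" for f k
  proof -
    interpret J: prob_space "\<Pi>\<^sub>M j\<in>I. N" by (rule Pfin)
    interpret PZ: pair_sigma_finite "\<Pi>\<^sub>M j\<in>I. N" Z by unfold_locales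
    interpret NZ: pair_sigma_finite N Z by unfold_locales
    have m: "(\<lambda>(v, z). f (v k) * indicator {k} (nearest v z)) \<in> borel_measurable ((\<Pi>\<^sub>M k\<in>I. N) \<Otimes>\<^sub>M Z)"
      by measurable
    have "(\<integral>\<^sup>+ (v, z). f (v k) * indicator {k} (nearest v z) \<partial>((\<Pi>\<^sub>M k\<in>I. N) \<Otimes>\<^sub>M Z))
       = (\<integral>\<^sup>+ z. \<integral>\<^sup>+ v. f (v k) * indicator {k} (nearest v z) \<partial>(\<Pi>\<^sub>M k\<in>I. N) \<partial>Z)"
      using PZ.nn_integral_snd[OF m] by (simp add: case_prod_beta')
    \<comment> \<open>Coordinate \<open>k\<close> is split off the product; it is then the fixed
      value \<open>y\<close>, so \<open>f\<close> leaves the inner integral.\<close>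
    also have "\<dots> = (\<integral>\<^sup>+ z. \<integral>\<^sup>+ y. f y * (\<integral>\<^sup>+ v. indicator {k} (nearest (v(k := y)) z) \<partial>(\<Pi>\<^sub>M j\<in>I - {k}. N)) \<partial>N \<partial>Z)"
    proof (rule nn_integral_cong)
      fix z assume z: "z \<in> space Z"
      have "(\<lambda>v. f (v k) * indicator {k} (nearest v z)) \<in> borel_measurable (\<Pi>\<^sub>M k\<in>I. N)"
        using measurable_compose[OF measurable_Pair2'[OF z] m] by simp
      then have "(\<integral>\<^sup>+ v. f (v k) * indicator {k} (nearest v z) \<partial>(\<Pi>\<^sub>M k\<in>I. N)) =
        (\<integral>\<^sup>+ y. \<integral>\<^sup>+ v. f y * indicator {k} (nearest (v(k := y)) z) \<partial>(\<Pi>\<^sub>M j\<in>I - {k}. N) \<partial>N)"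
        using P.product_nn_integral_insert_rev[of "I - {k}" k "\<lambda>v. f (v k) * indicator {k} (nearest v z)"] I k
        by (simp add: insert_absorb)
      also have "\<dots> = (\<integral>\<^sup>+ y. f y * (\<integral>\<^sup>+ v. indicator {k} (nearest (v(k := y)) z) \<partial>(\<Pi>\<^sub>M j\<in>I - {k}. N)) \<partial>N)"
        by (intro nn_integral_cong nn_integral_cmult slice k z)
      finally show "(\<integral>\<^sup>+ v. f (v k) * indicator {k} (nearest v z) \<partial>(\<Pi>\<^sub>M k\<in>I. N)) = \<dots>" .
    qed
    also have "\<dots> = (\<integral>\<^sup>+ y. \<integral>\<^sup>+ z. f y * (\<integral>\<^sup>+ v. indicator {k} (nearest (v(k := y)) z) \<partial>(\<Pi>\<^sub>M j\<in>I - {k}. N)) \<partial>Z \<partial>N)"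
    proof (rule NZ.Fubini')
      show "(\<lambda>(y, z). f y * (\<integral>\<^sup>+ v. indicator {k} (nearest (v(k := y)) z) \<partial>(\<Pi>\<^sub>M j\<in>I - {k}. N))) \<in> borel_measurable (N \<Otimes>\<^sub>M Z)"
        using borel_measurable_times_ennreal[OF measurable_compose[OF measurable_fst, of f N borel Z]
            inner_meas[OF k, unfolded case_prod_beta']]
        by (simp add: case_prod_beta')
    qed
    also have "\<dots> = (\<integral>\<^sup>+ y. f y * w k y \<partial>N)"
      unfolding w_def by (intro nn_integral_cong nn_integral_cmult slice2 k)
    finally show ?thesis .
  qed
  have W_eq: "(\<integral>\<^sup>+ (v, z). f (v (nearest v z)) \<partial>((\<Pi>\<^sub>M k\<in>I. N) \<Otimes>\<^sub>M Z)) = (\<integral>\<^sup>+ y. f y * W y \<partial>N)"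
    if [measurable]: "f \<in> borel_measurable N" for f
  proof -
    have "(\<integral>\<^sup>+ (v, z). f (v (nearest v z)) \<partial>((\<Pi>\<^sub>M k\<in>I. N) \<Otimes>\<^sub>M Z)) =
      (\<integral>\<^sup>+ p. (\<Sum>k\<in>I. f (fst p k) * indicator {k} (nearest (fst p) (snd p))) \<partial>((\<Pi>\<^sub>M k\<in>I. N) \<Otimes>\<^sub>M Z))"
    proof (rule nn_integral_cong, clarsimp simp: space_pair_measure)
      fix v z assume "z \<in> space Z"
      from nearest_index_argmin[OF this, of v] have "nearest v z \<in> I" by simp
      \<comment> \<open>Exactly one index of \<open>I\<close> is selected, so a single summand
        survives.\<close>
      then show "f (v (nearest v z)) = (\<Sum>k\<in>I. f (v k) * indicator {k} (nearest v z))"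
        using I by (simp add: indicator_def sum.delta if_distrib cong: if_cong)
    qed
    also have "\<dots> = (\<Sum>k\<in>I. \<integral>\<^sup>+ p. f (fst p k) * indicator {k} (nearest (fst p) (snd p)) \<partial>((\<Pi>\<^sub>M k\<in>I. N) \<Otimes>\<^sub>M Z))"
      by (rule nn_integral_sum) measurable
    also have "\<dots> = (\<Sum>k\<in>I. \<integral>\<^sup>+ y. f y * w k y \<partial>N)"
      using term_eq[OF that] by (intro sum.cong) (auto simp: case_prod_beta')
    also have "\<dots> = (\<integral>\<^sup>+ y. f y * W y \<partial>N)"
      unfolding W_def sum_distrib_left by (rule nn_integral_sum[symmetric]) (use w_meas in measurable)
    finally show ?thesis .
  qed
  have box: "emeasure (\<Pi>\<^sub>M j\<in>I - {k}. N) (\<Pi>\<^sub>E j\<in>I - {k}. A) = emeasure N A ^ (card I - 1)"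
    if "k \<in> I" "A \<in> sets N" for k A
    using that I by (subst P.emeasure_PiM) auto
  have upper: "w k y \<le> emeasure N {y'\<in>space N. D y \<le> D y'} ^ (card I - 1)"
    if k: "k \<in> I" and y: "y \<in> space N" for k y
  proof -
    let ?B = "\<Pi>\<^sub>E j\<in>I - {k}. {y'\<in>space N. D y \<le> D y'}"
    have "w k y \<le> (\<integral>\<^sup>+ z. \<integral>\<^sup>+ v. indicator ?B v \<partial>(\<Pi>\<^sub>M j\<in>I - {k}. N) \<partial>Z)"
      unfolding w_def
    proof (intro nn_integral_mono)
      fix z v assume z: "z \<in> space Z" and v: "v \<in> space (\<Pi>\<^sub>M j\<in>I - {k}. N)"
      \<comment> \<open>If \<open>k\<close> is selected, minimality puts every other sample at
        distance at least \<open>D y\<close>.\<close>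
      from nearest_index_argmin[OF z, of "v(k := y)"] v
      show "indicator {k} (nearest (v(k := y)) z) \<le> (indicator ?B v :: ennreal)"
        by (auto simp: indicator_def space_PiM PiE_iff split: if_splits)
    qed
    also have "\<dots> = emeasure (\<Pi>\<^sub>M j\<in>I - {k}. N) ?B"
      using I by (simp add: Z.emeasure_space_1 sets_PiM_I_finite)
    finally show ?thesis using box[OF k, of "{y'\<in>space N. D y \<le> D y'}"] by simp
  qed
  have lower: "emeasure N {y'\<in>space N. D y < D y'} ^ (card I - 1) \<le> w k y"
    if k: "k \<in> I" and y: "y \<in> space N" for k y
  proof -
    let ?B = "\<Pi>\<^sub>E j\<in>I - {k}. {y'\<in>space N. D y < D y'}"
    have "emeasure N {y'\<in>space N. D y < D y'} ^ (card I - 1) = emeasure (\<Pi>\<^sub>M j\<in>I - {k}. N) ?B"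
      using box[OF k, of "{y'\<in>space N. D y < D y'}"] by simp
    also have "\<dots> = (\<integral>\<^sup>+ z. \<integral>\<^sup>+ v. indicator ?B v \<partial>(\<Pi>\<^sub>M j\<in>I - {k}. N) \<partial>Z)"
      using I by (simp add: Z.emeasure_space_1 sets_PiM_I_finite)
    also have "\<dots> \<le> w k y"
      unfolding w_def
    proof (intro nn_integral_mono)
      fix z v assume z: "z \<in> space Z" and v: "v \<in> space (\<Pi>\<^sub>M j\<in>I - {k}. N)"
      \<comment> \<open>Any other selected index would be strictly farther than \<open>D y\<close>
        by the box and at most \<open>D y\<close> by minimality.\<close>
      have "nearest (v(k := y)) z = k" if "v \<in> ?B"
      proof (rule ccontr)
        assume *: "nearest (v(k := y)) z \<noteq> k"
        with nearest_index_argmin[OF z, of "v(k := y)"] that have "D y < D (v (nearest (v(k := y)) z))"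
          by (auto simp: PiE_iff)
        moreover from nearest_index_argmin[OF z, of "v(k := y)"] k * have "D (v (nearest (v(k := y)) z)) \<le> D y"
          by (metis fun_upd_apply)
        ultimately show False by simp
      qed
      then show "(indicator ?B v :: ennreal) \<le> indicator {k} (nearest (v(k := y)) z)"
        by (simp add: indicator_def)
    qed
    finally show ?thesis .
  qed
  show thesis
  proof (rule that[of W])
    show "W \<in> borel_measurable N"
      unfolding W_def[abs_def] using w_meas by measurable
    show "(\<integral>\<^sup>+ (v, z). f (v (nearest v z)) \<partial>((\<Pi>\<^sub>M k\<in>I. N) \<Otimes>\<^sub>M Z)) = (\<integral>\<^sup>+ y. f y * W y \<partial>N)"
      if "f \<in> borel_measurable N" for f by (rule W_eq[OF that])
    show "W y \<le> of_nat (card I) * emeasure N {y'\<in>space N. D y \<le> D y'} ^ (card I - 1)" if "y \<in> space N" for y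
      unfolding W_def using sum_bounded_above[of I "\<lambda>k. w k y"] upper[OF _ that] by simp
    show "of_nat (card I) * emeasure N {y'\<in>space N. D y < D y'} ^ (card I - 1) \<le> W y" if "y \<in> space N" for y
      unfolding W_def using sum_bounded_below[of I _ "\<lambda>k. w k y"] lower[OF _ that] by simp
    show "W y = W y'" if "D y = D y'" for y y'
    proof -
      \<comment> \<open>The rule sees samples only through their distances, so pinning at
        \<open>y\<close> or at \<open>y'\<close> gives it the same input.\<close>
      have "(\<lambda>j\<in>I. D ((v(k := y)) j)) = (\<lambda>j\<in>I. D ((v(k := y')) j))" for v k
        using that by (auto simp: fun_eq_iff restrict_def)
      then show ?thesis unfolding W_def w_def nearest_index_def by simp
    qed
  qed
qed

end

section \<open>Reducing the infinite sample space to finitely many coordinates\<close>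

lemma distr_pair_snd:
  assumes "prob_space L" "sigma_finite_measure K"
  shows "distr (L \<Otimes>\<^sub>M K) K snd = K"
proof (rule measure_eqI)
  interpret L: prob_space L by fact
  interpret K: sigma_finite_measure K by fact
  fix A assume "A \<in> sets (distr (L \<Otimes>\<^sub>M K) K snd)"
  then have [measurable]: "A \<in> sets K" by simp
  have "snd -` A \<inter> space (L \<Otimes>\<^sub>M K) = space L \<times> A"
    using sets.sets_into_space[of A K] by (auto simp: space_pair_measure)
  then show "emeasure (distr (L \<Otimes>\<^sub>M K) K snd) A = emeasure K A"
    by (simp add: emeasure_distr K.emeasure_pair_measure_Times L.emeasure_space_1)
qed simp

text \<open>The first factor is projected away, and the two remaining factors are independent, so
  the joint law of their projections is the product of the two marginal laws.\<close>

lemma distr_sample_marginal: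
  assumes L: "prob_space L" and N: "prob_space N" and Z: "\<And>i. i \<in> B \<Longrightarrow> prob_space (Z i)"
    and J: "finite J" "J \<subseteq> A" and m: "m \<in> B"
  shows "distr (L \<Otimes>\<^sub>M ((\<Pi>\<^sub>M k\<in>A. N) \<Otimes>\<^sub>M (\<Pi>\<^sub>M i\<in>B. Z i))) ((\<Pi>\<^sub>M k\<in>J. N) \<Otimes>\<^sub>M Z m)
      (\<lambda>\<omega>. (restrict (fst (snd \<omega>)) J, snd (snd \<omega>) m)) = (\<Pi>\<^sub>M k\<in>J. N) \<Otimes>\<^sub>M Z m"
proof -
  interpret P: product_prob_space "\<lambda>_. N" A
    using N by (auto simp: product_prob_space_def product_prob_space_axioms_def product_sigma_finite_def
        prob_space_imp_sigma_finite)
  interpret PA: prob_space "\<Pi>\<^sub>M k\<in>A. N" by (rule prob_space_PiM) (rule N)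
  interpret QB: prob_space "\<Pi>\<^sub>M i\<in>B. Z i" by (rule prob_space_PiM) (rule Z)
  interpret PQ: pair_prob_space "\<Pi>\<^sub>M k\<in>A. N" "\<Pi>\<^sub>M i\<in>B. Z i" ..
  let ?K = "(\<Pi>\<^sub>M k\<in>A. N) \<Otimes>\<^sub>M (\<Pi>\<^sub>M i\<in>B. Z i)"
  let ?T = "(\<Pi>\<^sub>M k\<in>J. N) \<Otimes>\<^sub>M Z m"
  have r[measurable]: "(\<lambda>v. restrict v J) \<in> (\<Pi>\<^sub>M k\<in>A. N) \<rightarrow>\<^sub>M (\<Pi>\<^sub>M k\<in>J. N)"
    by (rule measurable_restrict_subset) (rule J)
  have c[measurable]: "(\<lambda>z. z m) \<in> (\<Pi>\<^sub>M i\<in>B. Z i) \<rightarrow>\<^sub>M Z m"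
    using m by (rule measurable_component_singleton)
  have Zm: "distr (\<Pi>\<^sub>M i\<in>B. Z i) (Z m) (\<lambda>z. z m) = Z m"
    by (rule distr_PiM_component[OF Z m])
  have "distr (L \<Otimes>\<^sub>M ?K) ?T (\<lambda>\<omega>. (restrict (fst (snd \<omega>)) J, snd (snd \<omega>) m))
      = distr (distr (L \<Otimes>\<^sub>M ?K) ?K snd) ?T (\<lambda>(v, z). (restrict v J, z m))"
    by (subst distr_distr) (auto simp: comp_def case_prod_beta')
  also have "\<dots> = distr ?K ?T (\<lambda>(v, z). (restrict v J, z m))"
    using distr_pair_snd[OF L PQ.sigma_finite_measure_axioms] by simp
  also have "\<dots> = distr (\<Pi>\<^sub>M k\<in>A. N) (\<Pi>\<^sub>M k\<in>J. N) (\<lambda>v. restrict v J) \<Otimes>\<^sub>M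
      distr (\<Pi>\<^sub>M i\<in>B. Z i) (Z m) (\<lambda>z. z m)"
    by (rule pair_measure_distr[symmetric, OF r c])
      (simp add: Zm prob_space_imp_sigma_finite Z m)
  also have "\<dots> = ?T"
    unfolding Zm by (simp add: P.distr_PiM_restrict_finite J)
  finally show ?thesis .
qed

text \<open>The selected sample is a function of the first \<open>m\<close> samples and of the
  \<open>m\<close>-th tie-breaking variable, so the expectation transfers to their joint
  law.\<close>

lemma nn_integral_nn_sample:
  fixes N :: "'a::metric_space measure"
  assumes N: "prob_space N" and Z: "\<And>i. i \<ge> 1 \<Longrightarrow> prob_space (Z i)"
    and m: "m \<ge> 1" and sel: "argmin_selection N (Z m) (dist x) (\<psi> m) {1..m}"
    and f: "f \<in> borel_measurable N"
  shows "(\<integral>\<^sup>+ \<omega>. f (nn_sample \<psi> x m \<omega>) \<partial>(N \<Otimes>\<^sub>M ((\<Pi>\<^sub>M k\<in>{1..}. N) \<Otimes>\<^sub>M (\<Pi>\<^sub>M m\<in>{1..}. Z m)))) =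
    (\<integral>\<^sup>+ (v, z). f (v (nearest_index (dist x) (\<psi> m) {1..m} v z)) \<partial>((\<Pi>\<^sub>M k\<in>{1..m}. N) \<Otimes>\<^sub>M Z m))"
    (is "(\<integral>\<^sup>+ \<omega>. _ \<partial>?\<Omega>) = (\<integral>\<^sup>+ p. ?g p \<partial>?T)")
proof -
  interpret argmin_selection N "Z m" "dist x" "\<psi> m" "{1..m}" by fact
  let ?\<pi> = "\<lambda>\<omega>. (restrict (fst (snd \<omega>)) {1..m}, snd (snd \<omega>) m)"
  have g: "?g \<in> borel_measurable ?T"
    using measurable_compose[OF measurable_selected f] by (simp add: case_prod_beta')
  have r: "(\<lambda>v. restrict v {1..m}) \<in> (\<Pi>\<^sub>M k\<in>{1..}. N) \<rightarrow>\<^sub>M (\<Pi>\<^sub>M k\<in>{1..m}. N)"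
    by (rule measurable_restrict_subset) auto
  have c: "(\<lambda>z. z m) \<in> (\<Pi>\<^sub>M i\<in>{1..}. Z i) \<rightarrow>\<^sub>M Z m"
    using m by (intro measurable_component_singleton) auto
  have \<pi>: "?\<pi> \<in> ?\<Omega> \<rightarrow>\<^sub>M ?T"
    by (rule measurable_Pair)
      (rule measurable_compose[OF measurable_compose[OF measurable_snd measurable_fst] r],
       rule measurable_compose[OF measurable_compose[OF measurable_snd measurable_snd] c])
  have "(\<integral>\<^sup>+ \<omega>. f (nn_sample \<psi> x m \<omega>) \<partial>?\<Omega>) = (\<integral>\<^sup>+ \<omega>. ?g (?\<pi> \<omega>) \<partial>?\<Omega>)"
  proof (rule nn_integral_cong)
    fix \<omega> assume "\<omega> \<in> space ?\<Omega>"
    then have "snd (snd \<omega>) m \<in> space (Z m)"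
      using m by (auto simp: space_pair_measure space_PiM PiE_iff)
    from nearest_index_argmin[OF this, of "fst (snd \<omega>)"]
    have *: "nearest (fst (snd \<omega>)) (snd (snd \<omega>) m) \<in> {1..m}" by blast
    have "nearest (restrict (fst (snd \<omega>)) {1..m}) (snd (snd \<omega>) m) = nearest (fst (snd \<omega>)) (snd (snd \<omega>) m)"
      unfolding nearest_index_def by (intro arg_cong2[where f = "\<psi> m"] refl) (auto simp: fun_eq_iff restrict_def)
    with * show "f (nn_sample \<psi> x m \<omega>) = ?g (?\<pi> \<omega>)"
      by (simp add: nn_sample_def Let_def nearest_index_def)
  qed
  also have "\<dots> = (\<integral>\<^sup>+ p. ?g p \<partial>distr ?\<Omega> ?T ?\<pi>)"
    using \<pi> g by (intro nn_integral_distr[symmetric]) auto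
  also have "distr ?\<Omega> ?T ?\<pi> = ?T"
    using m by (intro distr_sample_marginal N Z) auto
  finally show ?thesis .
qed

section \<open>Normalising the measure on the ball\<close>

text \<open>Used to cancel the normalising constant. With \<open>c\<close> nonzero and finite,
  \<open>a\<close> and \<open>b\<close> may be arbitrary, including 0 and
  \<open>top\<close>.\<close>

lemma divide_divide_same_ennreal:
  fixes a b c :: ennreal
  assumes "c \<noteq> 0" "c \<noteq> top"
  shows "(a / c) / (b / c) = a / b"
proof -
  have "inverse (inverse c) = c"
    using assms by (cases c) (auto simp: inverse_ennreal zero_less_iff_neq_zero)
  then have "inverse (b * inverse c) = inverse b * c"
    using assms by (subst ennreal_inverse_mult') (auto simp: zero_less_iff_neq_zero simp flip: less_top)
  then have "(a / c) / (b / c) = a * inverse b * (c * inverse c)"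
    by (simp add: divide_ennreal_def mult_ac)
  also have "c * inverse c = 1"
    using assms ennreal_divide_self by (simp add: divide_ennreal_def top.not_eq_extremum)
  finally show ?thesis by (simp add: divide_ennreal_def)
qed

text \<open>For \<open>r < R\<close> the small ball lies in the large one, so normalisation divides
  both the integral and the mass by the same constant. The limit at 0 sees only such radii.\<close>

lemma lebesgue_point_wrt_uniform_measure:
  assumes sets: "sets \<mu> = sets borel" and \<eta>: "\<eta> \<in> borel_measurable borel" and R: "0 < R"
    and fin: "emeasure \<mu> (cball x R) < \<infinity>" and pos: "emeasure \<mu> (cball x R) > 0"
  shows "lebesgue_point_wrt (uniform_measure \<mu> (cball x R)) \<eta> x \<longleftrightarrow> lebesgue_point_wrt \<mu> \<eta> x"
proof -
  note [measurable_cong] = sets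
  note [measurable] = \<eta>
  let ?N = "uniform_measure \<mu> (cball x R)"
  have eq: "(\<integral>\<^sup>+ y\<in>cball x r. ennreal \<bar>\<eta> y - \<eta> x\<bar> \<partial>?N) / emeasure ?N (cball x r)
      = (\<integral>\<^sup>+ y\<in>cball x r. ennreal \<bar>\<eta> y - \<eta> x\<bar> \<partial>\<mu>) / emeasure \<mu> (cball x r)"
    if r: "r < R" for r
  proof -
    have sub: "cball x R \<inter> cball x r = cball x r" using r by auto
    have cb[measurable]: "cball x s \<in> sets \<mu>" for s by (simp add: sets)
    have 1: "(\<integral>\<^sup>+ y\<in>cball x r. ennreal \<bar>\<eta> y - \<eta> x\<bar> \<partial>?N)
        = (\<integral>\<^sup>+ y\<in>cball x r. ennreal \<bar>\<eta> y - \<eta> x\<bar> \<partial>\<mu>) / emeasure \<mu> (cball x R)"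
      using r by (subst nn_integral_uniform_measure, measurable)
        (auto intro!: arg_cong2[where f = "(/)"] nn_integral_cong simp: indicator_def)
    have 2: "emeasure ?N (cball x r) = emeasure \<mu> (cball x r) / emeasure \<mu> (cball x R)"
      by (simp add: emeasure_uniform_measure sub)
    show ?thesis
      unfolding 1 2 using fin pos by (intro divide_divide_same_ennreal) auto
  qed
  show ?thesis
    unfolding lebesgue_point_wrt_def
    by (rule tendsto_cong) (use eq R in \<open>auto simp: eventually_at_right_field intro!: exI[of _ R]\<close>)
qed

section \<open>Instantiation and conclusion\<close>

theorem mainTheorem13:
  fixes \<mu> :: "'a::metric_space measure"
    and \<eta> :: "'a \<Rightarrow> real"
    and x :: 'a and R :: real
    and Z :: "nat \<Rightarrow> 'z measure"
    and \<psi> :: "nat \<Rightarrow> (nat \<Rightarrow> real) \<Rightarrow> 'z \<Rightarrow> nat"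
  assumes sets_\<mu>: "sets \<mu> = sets borel"
    and \<eta>_meas: "\<eta> \<in> borel_measurable borel"
    and pos: "\<And>r. r > 0 \<Longrightarrow> emeasure \<mu> (cball x r) > 0"
    and R_pos: "R > 0"
    and R_fin: "emeasure \<mu> (cball x R) < \<infinity>"
    and Z_prob: "\<And>m. m \<ge> 1 \<Longrightarrow> prob_space (Z m)"
    and \<psi>_meas: "\<And>m. m \<ge> 1 \<Longrightarrow>
        (\<lambda>(r, z). \<psi> m r z) \<in> measurable
          ((\<Pi>\<^sub>M k\<in>{1..m}. restrict_space borel {0::real..}) \<Otimes>\<^sub>M Z m) (count_space UNIV)"
    and \<psi>_argmin: "\<And>m r z. m \<ge> 1 \<Longrightarrow> r \<in> (\<Pi>\<^sub>E k\<in>{1..m}. {0::real..}) \<Longrightarrow> z \<in> space (Z m) \<Longrightarrow>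
        \<psi> m r z \<in> {1..m} \<and> (\<forall>k\<in>{1..m}. r (\<psi> m r z) \<le> r k)"
    and bdd: "bounded (\<eta> ` cball x R)"
  shows "lebesgue_point_wrt \<mu> \<eta> x \<longleftrightarrow>
    ((\<lambda>m. \<integral>\<^sup>+ \<omega>. ennreal \<bar>\<eta> (nn_sample \<psi> x m \<omega>) - \<eta> x\<bar>
        \<partial>(uniform_measure \<mu> (cball x R) \<Otimes>\<^sub>M
           ((\<Pi>\<^sub>M k\<in>{1..}. uniform_measure \<mu> (cball x R)) \<Otimes>\<^sub>M (\<Pi>\<^sub>M m\<in>{1..}. Z m))))
      \<longlongrightarrow> 0) sequentially"
proof -
  define N where "N = uniform_measure \<mu> (cball x R)"
  define f where "f y = ennreal \<bar>\<eta> y - \<eta> x\<bar>" for y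
  have sets_N[measurable_cong, simp]: "sets N = sets borel" by (simp add: N_def sets_\<mu>)
  have space_N[simp]: "space N = UNIV" using sets_eq_imp_space_eq[OF sets_N] by simp
  have cball_\<mu>: "cball x r \<in> sets \<mu>" for r by (simp add: sets_\<mu>)
  have N: "prob_space N"
    unfolding N_def using pos[OF R_pos] R_fin by (intro prob_space_uniform_measure) auto
  note [measurable] = \<eta>_meas
  have f_meas: "f \<in> borel_measurable N" unfolding f_def[abs_def] by measurable
  have dist_meas: "dist x \<in> borel_measurable N"
    unfolding measurable_cong_sets[OF sets_N refl]
    by (intro borel_measurable_continuous_onI continuous_intros)
  have sel: "argmin_selection N (Z m) (dist x) (\<psi> m) {1..m}" if "m \<ge> 1" for m
    using N Z_prob[OF that] dist_meas \<psi>_meas[OF that] \<psi>_argmin[OF that]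
    by (auto simp: argmin_selection_def argmin_selection_axioms_def)
  \<comment> \<open>Bundling the properties of a weight into one predicate allows weights for all
    sample sizes to be chosen at once.\<close>
  define P where "P m W \<longleftrightarrow> W \<in> borel_measurable N \<and>
      (\<forall>g\<in>borel_measurable N. (\<integral>\<^sup>+ \<omega>. g (nn_sample \<psi> x m \<omega>)
         \<partial>(N \<Otimes>\<^sub>M ((\<Pi>\<^sub>M k\<in>{1..}. N) \<Otimes>\<^sub>M (\<Pi>\<^sub>M m\<in>{1..}. Z m)))) = (\<integral>\<^sup>+ y. g y * W y \<partial>N)) \<and>
      (\<forall>y. W y \<le> of_nat m * emeasure N {y'\<in>space N. dist x y \<le> dist x y'} ^ (m - 1)) \<and>
      (\<forall>y. of_nat m * emeasure N {y'\<in>space N. dist x y < dist x y'} ^ (m - 1) \<le> W y) \<and>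
      (\<forall>y y'. dist x y = dist x y' \<longrightarrow> W y = W y')" for m W
  have "\<exists>W. P m W" if m: "m \<ge> 1" for m
  proof -
    interpret argmin_selection N "Z m" "dist x" "\<psi> m" "{1..m}" by (rule sel[OF m])
    show ?thesis
    proof (rule selected_density, goal_cases)
      case (1 W)
      note sample = nn_integral_nn_sample[where \<psi> = \<psi> and Z = Z, OF N Z_prob m sel[OF m]]
      show ?case
      proof (unfold P_def, intro exI[of _ W] conjI ballI allI impI)
        fix g :: "'a \<Rightarrow> ennreal" assume g: "g \<in> borel_measurable N"
        show "(\<integral>\<^sup>+ \<omega>. g (nn_sample \<psi> x m \<omega>)
            \<partial>(N \<Otimes>\<^sub>M ((\<Pi>\<^sub>M k\<in>{1..}. N) \<Otimes>\<^sub>M (\<Pi>\<^sub>M m\<in>{1..}. Z m)))) = (\<integral>\<^sup>+ y. g y * W y \<partial>N)"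
          using sample[OF _ g] 1(2)[OF g] by simp
      next
        fix y y' assume "dist x y = dist x y'"
        then show "W y = W y'" by (rule 1(5))
      qed (use 1(1,3,4) in simp_all)
    qed
  qed
  then obtain W where "P m (W m)" if "m \<ge> 1" for m by metis
  note PW = this[unfolded P_def]
  note W = PW[THEN conjunct1]
    PW[THEN conjunct2, THEN conjunct1, rule_format]
    PW[THEN conjunct2, THEN conjunct2, THEN conjunct1, rule_format]
    PW[THEN conjunct2, THEN conjunct2, THEN conjunct2, THEN conjunct1, rule_format]
    PW[THEN conjunct2, THEN conjunct2, THEN conjunct2, THEN conjunct2, rule_format]
  obtain c where c: "\<And>y. y \<in> cball x R \<Longrightarrow> \<bar>\<eta> y\<bar> \<le> c"
    using bdd unfolding bounded_iff by (auto simp del: mem_cball)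
  have "0 \<le> c" using c[of x] R_pos by auto
  \<comment> \<open>The constant \<open>2 * c\<close> comes from the triangle inequality, as
    \<open>x\<close> itself lies in the ball.\<close>
  interpret nearest_weights N "dist x" f W "2 * c"
  proof (intro nearest_weights.intro nearest_weights_axioms.intro)
    show "prob_space N" by (rule N)
    show "AE y in N. f y \<le> ennreal (2 * c)"
      unfolding N_def
    proof (rule AE_uniform_measureI[OF cball_\<mu>], rule AE_I2, rule impI)
      fix y assume "y \<in> cball x R"
      then show "f y \<le> ennreal (2 * c)"
        unfolding f_def using c[of y] c[of x] R_pos by (intro ennreal_leI) auto
    qed
    show "(\<integral>\<^sup>+ y. W m y \<partial>N) = 1" if m: "m \<ge> 1" for m
    proof -
      have "prob_space (N \<Otimes>\<^sub>M ((\<Pi>\<^sub>M k\<in>{1::nat..}. N) \<Otimes>\<^sub>M (\<Pi>\<^sub>M m\<in>{1::nat..}. Z m)))"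
        by (intro prob_space_pair N prob_space_PiM Z_prob) simp
      from prob_space.emeasure_space_1[OF this] show ?thesis
        \<comment> \<open>Testing the density identity against the constant 1 gives total weight
          1.\<close>
        using W(2)[OF m, of "\<lambda>_. 1"] by simp
    qed
    show "0 < emeasure N {y\<in>space N. dist x y \<le> r}" if "0 < r" for r
    proof -
      \<comment> \<open>The minimum keeps the ball inside \<open>cball x R\<close>, where
        \<open>N\<close> lives, even when \<open>r\<close> exceeds \<open>R\<close>.\<close>
      have "0 < emeasure \<mu> (cball x (min R r))" using that R_pos by (intro pos) simp
      also have "\<dots> \<le> emeasure \<mu> (cball x R \<inter> cball x r)"
        by (intro emeasure_mono sets.Int cball_\<mu>) auto
      finally have "0 < emeasure N (cball x r)"
        using R_fin by (simp add: N_def emeasure_uniform_measure cball_\<mu> ennreal_zero_less_divide)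
      then show ?thesis by (simp add: cball_def)
    qed
    show "W m \<in> borel_measurable N" if "m \<ge> 1" for m
      by (rule W(1)[OF that])
    show "W m y \<le> of_nat m * emeasure N {y'\<in>space N. dist x y \<le> dist x y'} ^ (m - 1)" if "m \<ge> 1" for m y
      by (rule W(3)[OF that])
    show "of_nat m * emeasure N {y'\<in>space N. dist x y < dist x y'} ^ (m - 1) \<le> W m y" if "m \<ge> 1" for m y
      by (rule W(4)[OF that])
    show "W m y = W m y'" if "m \<ge> 1" "dist x y = dist x y'" for m y y'
      by (rule W(5)[OF that])
  qed (use \<open>0 \<le> c\<close> dist_meas f_meas in \<open>auto simp: f_def\<close>)
  have "lebesgue_point_wrt \<mu> \<eta> x \<longleftrightarrow> lebesgue_point_wrt N \<eta> x"
    unfolding N_def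
    using lebesgue_point_wrt_uniform_measure[OF sets_\<mu> \<eta>_meas R_pos R_fin pos[OF R_pos]] by simp
  also have "\<dots> \<longleftrightarrow> (average \<longlongrightarrow> 0) (at_right 0)"
    by (simp add: lebesgue_point_wrt_def cball_def f_def)
  also have "\<dots> \<longleftrightarrow> (\<lambda>m. \<integral>\<^sup>+ y. f y * W m y \<partial>N) \<longlonglongrightarrow> 0"
    by (rule average_tendsto_0_iff)
  also have "\<dots> \<longleftrightarrow> ((\<lambda>m. \<integral>\<^sup>+ \<omega>. f (nn_sample \<psi> x m \<omega>)
      \<partial>(N \<Otimes>\<^sub>M ((\<Pi>\<^sub>M k\<in>{1..}. N) \<Otimes>\<^sub>M (\<Pi>\<^sub>M m\<in>{1..}. Z m)))) \<longlonglongrightarrow> 0)"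
    \<comment> \<open>The density identity starts at \<open>m = 1\<close>; equality from there on
      suffices for the limit.\<close>
    by (rule tendsto_cong)
      (use W(2)[OF _ f_meas] in \<open>auto simp: eventually_sequentially intro!: exI[of _ 1]\<close>)
  finally show ?thesis by (simp add: f_def N_def)
qed

end
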